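(* Let $1\le k\le n$, $A\in\mathbb{R}^{m\times n}$, $b\in\mathbb{R}^m$, $\rho>0$, and let $L\in\mathbb{R}^{k\times n}$ have full row rank. If $k<n$, let $F\in\mathbb{R}^{n\times(n-k)}$ have columns forming an orthonormal basis of the null space of $L$, put $$l_2=\lambda_{\min}\begin{bmatrix}F^TA^TAF&F^TA^Tb\\ b^TAF&\|b\|^2\end{bmatrix},$$ and assume $l_2<\lambda_{\min}(F^TA^TAF)$. Suppose $A^Tb\ne0$. Let $x^*$ be an optimal solution of $$\min_{x\in\mathbb{R}^n}\ \frac{\|Ax-b\|^2}{\|x\|^2+1}+\rho\|Lx\|^2.$$ Define $$\kappa_1=\begin{cases}\|b\|^2-b^TA(A^TA+\rho L^TL)^{-1}A^Tb,&k=n,\\ \min\{l_2,\ \|b\|^2-b^TA(A^TA+\rho L^TL)^{-1}A^Tb\},&k<n,\end{cases}$$ and $\kappa_2=\lambda_{\min}(A^TA+\rho L^TL)-\kappa_1$. Then $\kappa_1<\|b\|^2$ and $$\|x^*\|\ \ge\ \begin{cases}\dfrac{\|b\|^2-\kappa_1}{2\|A^Tb\|},&\kappa_2=0,\\[2mm] \dfrac{\|A^Tb\|-\sqrt{\|A^Tb\|^2-\kappa_2(\|b\|^2-\kappa_1)}}{\kappa_2},&\text{otherwise}.\end{cases}$$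
   Context: $\lambda_{\min}(\cdot)$ is the smallest eigenvalue of a symmetric matrix; $\|\cdot\|$ is the Euclidean norm. Under the stated assumptions $A^TA+\rho L^TL$ is positive definite, so the inverse exists. *)

theory Defs
  imports "HOL-Analysis.Analysis"
begin

definition eigenvalues :: "real^'n^'n \<Rightarrow> real set"
  where "eigenvalues M = {c. \<exists>v. v \<noteq> 0 \<and> M *v v = c *\<^sub>R v}"

text \<open>Only meaningful for symmetric \<open>M\<close>, whose set of real eigenvalues is finite and nonempty.\<close>

definition lambda_min :: "real^'n^'n \<Rightarrow> real"
  where "lambda_min M = Min (eigenvalues M)"

definition null_space :: "real^'n^'m \<Rightarrow> (real^'n) set"
  where "null_space L = {x. L *v x = 0}"

text \<open>Orthonormality is stated by index, so that repeated columns are excluded.\<close>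

definition columns_orthonormal_basis :: "real^'p^'n \<Rightarrow> (real^'n) set \<Rightarrow> bool"
  where "columns_orthonormal_basis F S \<longleftrightarrow>
    (\<forall>i j. column i F \<bullet> column j F = (if i = j then 1 else 0)) \<and> span (columns F) = S"

text \<open>The block matrix with rows \<open>[M, u]\<close> and \<open>[v, c]\<close>, where \<open>u\<close> is a column, \<open>v\<close> a row and
  \<open>c\<close> a scalar; the index \<open>Inr ()\<close> is the additional last row and column.\<close>

definition bordered_matrix ::
    "real^'p^'p \<Rightarrow> real^'p \<Rightarrow> real^'p \<Rightarrow> real \<Rightarrow> real^('p + unit)^('p + unit)"
  where "bordered_matrix M u v c =
    (\<chi> i j. case i of
       Inl p \<Rightarrow> (case j of Inl q \<Rightarrow> M $ p $ q | Inr _ \<Rightarrow> u $ p)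
     | Inr _ \<Rightarrow> (case j of Inl q \<Rightarrow> v $ q | Inr _ \<Rightarrow> c))"

definition rtls_objective ::
    "real^'n^'m \<Rightarrow> real^'m \<Rightarrow> real \<Rightarrow> real^'n^'k \<Rightarrow> real^'n \<Rightarrow> real"
  where "rtls_objective A b \<rho> L x =
    (norm (A *v x - b))\<^sup>2 / ((norm x)\<^sup>2 + 1) + \<rho> * (norm (L *v x))\<^sup>2"

end

theory Submission
  imports Defs
begin

text \<open>Replacing the weight \<open>1 + \<parallel>x\<parallel>\<^sup>2\<close> of the regularisation term by \<open>1\<close> shows that
  \<open>(1 + \<parallel>x\<parallel>\<^sup>2)\<close> times the objective is at least \<open>\<parallel>Ax - b\<parallel>\<^sup>2 + \<rho>\<parallel>Lx\<parallel>\<^sup>2\<close>, which is a quadratic with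
  matrix \<open>B = A\<^sup>TA + \<rho>L\<^sup>TL\<close>. The optimal value is at most \<open>\<kappa>1\<close>: the point \<open>B\<^sup>-\<^sup>1A\<^sup>Tb\<close> has objective at
  most \<open>\<parallel>b\<parallel>\<^sup>2 - b\<^sup>TAB\<^sup>-\<^sup>1A\<^sup>Tb\<close>, and an eigenvector \<open>(y, s)\<close> for \<open>l2\<close> has \<open>s \<noteq> 0\<close> and gives the point
  \<open>-Fy/s\<close> of the null space of \<open>L\<close>, with objective exactly \<open>l2\<close>. Hence \<open>t = \<parallel>x\<^sup>*\<parallel>\<close> satisfies
  \<open>\<kappa>2 t\<^sup>2 - 2\<parallel>A\<^sup>Tb\<parallel> t + \<parallel>b\<parallel>\<^sup>2 - \<kappa>1 \<le> 0\<close>, and the bound is the relevant root of this quadratic.\<close>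

section \<open>Spectral facts for real symmetric matrices\<close>

lemma inner_symmetric_matrix:
  fixes M :: "real^'n^'n"
  assumes "transpose M = M"
  shows "(M *v x) \<bullet> y = x \<bullet> (M *v y)"
  using dot_lmul_matrix[of x M y] transpose_matrix_vector[of M x] assms by simp

text \<open>Eigenvectors chosen for distinct eigenvalues are orthogonal, hence independent.
  Finiteness is what makes the \<open>Min\<close> in \<open>lambda_min\<close> meaningful.\<close>

lemma finite_eigenvalues:
  fixes M :: "real^'n^'n"
  assumes sym: "transpose M = M"
  shows "finite (eigenvalues M)"
proof -
  have "\<forall>c\<in>eigenvalues M. \<exists>v. v \<noteq> 0 \<and> M *v v = c *\<^sub>R v"
    by (simp add: eigenvalues_def)
  then obtain e where e: "\<And>c. c \<in> eigenvalues M \<Longrightarrow> e c \<noteq> 0 \<and> M *v e c = c *\<^sub>R e c"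
    by metis
  have orth: "e c \<bullet> e d = 0" if "c \<in> eigenvalues M" "d \<in> eigenvalues M" "c \<noteq> d" for c d
  proof -
    have "c * (e c \<bullet> e d) = d * (e c \<bullet> e d)"
      using inner_symmetric_matrix[OF sym, of "e c" "e d"] e that by simp
    then show ?thesis using that by simp
  qed
  have inj: "inj_on e (eigenvalues M)"
    using orth e by (metis inj_onI inner_eq_zero_iff)
  have "pairwise orthogonal (e ` eigenvalues M)"
    using orth by (auto simp: pairwise_def orthogonal_def)
  moreover have "0 \<notin> e ` eigenvalues M"
    using e by auto
  ultimately have "independent (e ` eigenvalues M)"
    by (rule pairwise_orthogonal_independent)
  then have "finite (e ` eigenvalues M)"
    by (rule independent_imp_finite)
  with inj show ?thesis
    by (simp add: finite_image_iff)
qed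

text \<open>The form attains its minimum 0 at \<open>v\<close>. Moving from \<open>v\<close> in the
  direction \<open>- (N *v v)\<close> would lower it to first order unless \<open>N *v v\<close>
  vanished.\<close>

lemma psd_null_vector:
  fixes N :: "real^'n^'n"
  assumes sym: "transpose N = N" and psd: "\<And>x. x \<bullet> (N *v x) \<ge> 0" and v: "v \<bullet> (N *v v) = 0"
  shows "N *v v = 0"
proof -
  define w where "w = N *v v"
  define g where "g = w \<bullet> (N *v w)"
  have form_ge: "0 \<le> - 2 * t * (w \<bullet> w) + t^2 * g" for t
  proof -
    have "v \<bullet> (N *v w) = w \<bullet> w"
      using inner_symmetric_matrix[OF sym, of v w] by (simp add: w_def)
    then have "(v - t *\<^sub>R w) \<bullet> (N *v (v - t *\<^sub>R w)) = - 2 * t * (w \<bullet> w) + t^2 * g"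
      using v by (simp add: matrix_vector_mult_diff_distrib matrix_vector_mult_scaleR
          inner_diff_left inner_diff_right inner_commute[of v w] g_def power2_eq_square
          algebra_simps flip: w_def)
    with psd[of "v - t *\<^sub>R w"] show ?thesis by simp
  qed
  have g: "g \<ge> 0" using psd by (simp add: g_def)
  have "w \<bullet> w \<le> 0"
  proof (rule ccontr)
    assume "\<not> w \<bullet> w \<le> 0"
    then have W: "w \<bullet> w > 0" by linarith
    \<comment> \<open>This step length gives \<open>t * g \<le> w \<bullet> w\<close>, so the
      quadratic term is at most half the size of the linear one; adding 1 covers
      \<open>g = 0\<close>.\<close>
    define t where "t = (w \<bullet> w) / (g + 1)"
    have t: "t > 0" using W g by (simp add: t_def)
    have "t * g \<le> t * (g + 1)" using t by simp
    also have "\<dots> = w \<bullet> w" using g by (simp add: t_def)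
    finally have "t * (t * g) \<le> t * (w \<bullet> w)" using t by simp
    moreover have "t * (w \<bullet> w) > 0" using t W by simp
    ultimately show False using form_ge[of t] by (simp add: power2_eq_square mult.assoc)
  qed
  then have "w = 0"
    by (metis inner_ge_zero inner_eq_zero_iff order_antisym)
  then show ?thesis by (simp add: w_def)
qed

text \<open>By compactness the form has a minimum \<open>c0\<close> on the unit sphere, attained at
  some \<open>v\<close>. Then \<open>M - c0 *\<^sub>R mat 1\<close> is positive semidefinite and its
  form vanishes at \<open>v\<close>, so \<open>psd_null_vector\<close> makes \<open>c0\<close> an
  eigenvalue. Thus the spectrum is nonempty and \<open>lambda_min M \<le> c0\<close>.\<close>

lemma lambda_min_symmetric:
  fixes M :: "real^'n^'n"
  assumes sym: "transpose M = M"
  shows lambda_min_eigenvalue: "lambda_min M \<in> eigenvalues M"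
    and lambda_min_le_eigenvalue: "c \<in> eigenvalues M \<Longrightarrow> lambda_min M \<le> c"
    and lambda_min_le_quadratic_form: "lambda_min M * (x \<bullet> x) \<le> x \<bullet> (M *v x)"
proof -
  define S where "S = sphere (0 :: real^'n) 1"
  have "compact S" by (simp add: S_def)
  moreover have "axis undefined 1 \<in> S" by (simp add: S_def)
  then have "S \<noteq> {}" by blast
  moreover have "continuous_on S (\<lambda>x. x \<bullet> (M *v x))"
    by (intro continuous_intros linear_continuous_on matrix_vector_mul_bounded_linear)
  ultimately obtain v where v: "v \<in> S" and vmin: "\<And>x. x \<in> S \<Longrightarrow> v \<bullet> (M *v v) \<le> x \<bullet> (M *v x)"
    using continuous_attains_inf by metis
  define c0 where "c0 = v \<bullet> (M *v v)"
  have nv: "v \<bullet> v = 1" using v by (simp add: S_def norm_eq_1)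
  have ray: "c0 * (x \<bullet> x) \<le> x \<bullet> (M *v x)" for x
  proof (cases "x = 0")
    case False
    define u where "u = (1 / norm x) *\<^sub>R x"
    have "u \<in> S" using False by (simp add: u_def S_def)
    then have "c0 \<le> u \<bullet> (M *v u)" using vmin by (simp add: c0_def)
    also have "\<dots> = (x \<bullet> (M *v x)) / (x \<bullet> x)"
      by (simp add: u_def matrix_vector_mult_scaleR power2_eq_square[symmetric]
          power2_norm_eq_inner power_divide divide_simps)
    finally show ?thesis using False by (simp add: pos_le_divide_eq)
  qed simp
  define N where "N = M - c0 *\<^sub>R mat 1"
  have N: "N *v x = M *v x - c0 *\<^sub>R x" for x
    by (simp add: N_def matrix_vector_mult_diff_rdistrib scaleR_matrix_vector_assoc[symmetric])
  have "transpose N = N"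
  proof -
    have "N $ i $ j = N $ j $ i" for i j
      using arg_cong[OF sym, of "\<lambda>M. M $ i $ j"] by (simp add: N_def transpose_def mat_def)
    then show ?thesis by (simp add: transpose_def vec_eq_iff)
  qed
  then have "N *v v = 0"
    by (rule psd_null_vector) (use ray nv in \<open>auto simp: N inner_diff_right c0_def\<close>)
  then have c0: "c0 \<in> eigenvalues M"
    using nv by (auto simp: eigenvalues_def N intro!: exI[of _ v])
  have fin: "finite (eigenvalues M)" by (rule finite_eigenvalues[OF sym])
  show "lambda_min M \<in> eigenvalues M"
    unfolding lambda_min_def using fin c0 by (intro Min_in) auto
  show "lambda_min M \<le> c" if "c \<in> eigenvalues M" for c
    unfolding lambda_min_def using fin that by simp
  then have "lambda_min M \<le> c0" using c0 .
  then have "lambda_min M * (x \<bullet> x) \<le> c0 * (x \<bullet> x)" by (intro mult_right_mono) auto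
  with ray[of x] show "lambda_min M * (x \<bullet> x) \<le> x \<bullet> (M *v x)" by linarith
qed

section \<open>Bordered matrices, read blockwise\<close>

lemma sum_UNIV_plus_unit:
  fixes f :: "'p::finite + unit \<Rightarrow> real"
  shows "sum f UNIV = (\<Sum>p\<in>UNIV. f (Inl p)) + f (Inr ())"
  by (simp add: UNIV_Plus_UNIV[symmetric] sum.Plus UNIV_unit del: UNIV_Plus_UNIV)

lemma transpose_bordered_matrix:
  assumes "transpose M = M"
  shows "transpose (bordered_matrix M u u c) = bordered_matrix M u u c"
proof -
  have "M $ i $ j = M $ j $ i" for i j
    using arg_cong[OF assms, of "\<lambda>M. M $ i $ j"] by (simp add: transpose_def)
  then show ?thesis
    by (auto simp: vec_eq_iff transpose_def bordered_matrix_def split: sum.splits)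
qed

lemma bordered_matrix_eigenvalueE:
  assumes "c \<in> eigenvalues (bordered_matrix M u v d)"
  obtains y s where "y \<noteq> 0 \<or> s \<noteq> 0" "M *v y + s *\<^sub>R u = c *\<^sub>R y" "v \<bullet> y + d * s = c * s"
proof -
  obtain z where z: "z \<noteq> 0" "bordered_matrix M u v d *v z = c *\<^sub>R z"
    using assms by (auto simp: eigenvalues_def)
  define y where "y = (\<chi> p. z $ Inl p)"
  define s where "s = z $ Inr ()"
  have *: "(bordered_matrix M u v d *v z) $ i = c * z $ i" for i
    using z by simp
  show thesis
  proof (rule that)
    show "y \<noteq> 0 \<or> s \<noteq> 0"
    proof (rule ccontr)
      assume "\<not> (y \<noteq> 0 \<or> s \<noteq> 0)"
      then have "z $ i = 0" for i
        by (cases i) (auto simp: y_def s_def vec_eq_iff)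
      with z show False by (simp add: vec_eq_iff)
    qed
    show "M *v y + s *\<^sub>R u = c *\<^sub>R y"
      using *[of "Inl _"]
      by (simp add: vec_eq_iff matrix_vector_mult_def sum_UNIV_plus_unit bordered_matrix_def
          y_def s_def mult.commute)
    show "v \<bullet> y + d * s = c * s"
      using *[of "Inr ()"]
      by (simp add: matrix_vector_mult_def sum_UNIV_plus_unit bordered_matrix_def
          y_def s_def inner_vec_def)
  qed
qed

section \<open>Gram matrices and orthonormal columns\<close>

lemma transpose_gram: "transpose (transpose A ** A) = transpose A ** (A :: real^'n^'m)"
  by (simp add: matrix_transpose_mul transpose_transpose)

lemma inner_gram:
  fixes A :: "real^'n^'m"
  shows "x \<bullet> ((transpose A ** A) *v x) = (norm (A *v x))\<^sup>2"
  using dot_lmul_matrix[of "A *v x" A x]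
  by (simp add: inner_commute[of x] power2_norm_eq_inner flip: matrix_vector_mul_assoc)

lemma columns_orthonormal_basis_norm:
  fixes F :: "real^'p^'n"
  assumes "columns_orthonormal_basis F S"
  shows "norm (F *v y) = norm y"
proof -
  have "transpose F ** F = mat 1"
    using assms
    by (simp add: columns_orthonormal_basis_def vec_eq_iff
        matrix_mult_transpose_dot_column mat_def)
  then have "(norm (F *v y))\<^sup>2 = (norm y)\<^sup>2"
    using inner_gram[of y F] by (simp add: power2_norm_eq_inner)
  then show ?thesis by simp
qed

lemma columns_orthonormal_basis_range:
  fixes F :: "real^'p^'n"
  assumes "columns_orthonormal_basis F S"
  shows "range ((*v) F) = S"
proof -
  have "span (columns F) \<subseteq> range ((*v) F)"
    by (intro span_minimal linear_subspace_image subspace_UNIV matrix_vector_mul_linear)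
      (auto simp: columns_image_basis)
  moreover have "range ((*v) F) \<subseteq> span (columns F)"
    using matrix_vector_mult_in_columnspace by blast
  ultimately show ?thesis
    using assms by (auto simp: columns_orthonormal_basis_def)
qed

text \<open>The bordered matrix is the Gram matrix of \<open>G\<close> with \<open>b\<close>
  appended as a last column. Pairing the two block rows with \<open>y\<close> and \<open>s\<close>
  and adding yields the norm identity. The first block row is kept to exclude \<open>s = 0\<close>
  later.\<close>

lemma bordered_gram_eigenvalueE:
  fixes G :: "real^'p^'m" and b :: "real^'m"
  assumes "c \<in> eigenvalues (bordered_matrix (transpose G ** G) (transpose G *v b)
                              (transpose G *v b) ((norm b)\<^sup>2))"
  obtains y s where "y \<noteq> 0 \<or> s \<noteq> 0" "(transpose G ** G) *v y + s *\<^sub>R (transpose G *v b) = c *\<^sub>R y"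
    "(norm (G *v y + s *\<^sub>R b))\<^sup>2 = c * ((norm y)\<^sup>2 + s\<^sup>2)"
proof -
  obtain y s where ys: "y \<noteq> 0 \<or> s \<noteq> 0"
    and 1: "(transpose G ** G) *v y + s *\<^sub>R (transpose G *v b) = c *\<^sub>R y"
    and 2: "(transpose G *v b) \<bullet> y + (norm b)\<^sup>2 * s = c * s"
    using assms by (rule bordered_matrix_eigenvalueE)
  have b: "(transpose G *v b) \<bullet> y = b \<bullet> (G *v y)"
    by (simp add: dot_lmul_matrix)
  have "(norm (G *v y))\<^sup>2 + s * (b \<bullet> (G *v y)) = c * (norm y)\<^sup>2"
    using arg_cong[OF 1, of "\<lambda>z. y \<bullet> z"] b
    by (simp add: inner_add_right inner_gram inner_commute[of y "b v* G"] power2_norm_eq_inner)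
  moreover have "s * (b \<bullet> (G *v y)) + (norm b)\<^sup>2 * s\<^sup>2 = c * s\<^sup>2"
    using arg_cong[OF 2, of "\<lambda>z. s * z"] b by (simp add: algebra_simps power2_eq_square)
  moreover have "(norm (G *v y + s *\<^sub>R b))\<^sup>2
      = (norm (G *v y))\<^sup>2 + 2 * s * (b \<bullet> (G *v y)) + (norm b)\<^sup>2 * s\<^sup>2"
    unfolding power2_norm_eq_inner
    by (simp add: inner_add_left inner_add_right inner_commute[of "G *v y" b] power2_eq_square
        algebra_simps)
  ultimately have "(norm (G *v y + s *\<^sub>R b))\<^sup>2 = c * ((norm y)\<^sup>2 + s\<^sup>2)"
    by (simp add: algebra_simps)
  with that ys 1 show thesis by blast
qed

section \<open>A real quadratic inequality\<close>

text \<open>Multiplying the quadratic by \<open>a\<close> completes the square, so the sign of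
  \<open>a\<close> decides how \<open>(a * t - g)\<^sup>2\<close> compares with the discriminant.
  The latter is nonnegative in both nonzero cases.\<close>

lemma quadratic_nonpos_lower_bound:
  fixes a g c t :: real
  assumes "g > 0" "c > 0" "t \<ge> 0" and le: "a * t\<^sup>2 - 2 * g * t + c \<le> 0"
  shows "(if a = 0 then c / (2 * g) else (g - sqrt (g\<^sup>2 - a * c)) / a) \<le> t"
proof -
  have sq: "(a * t - g)\<^sup>2 - (g\<^sup>2 - a * c) = a * (a * t\<^sup>2 - 2 * g * t + c)"
    by (simp add: power2_eq_square algebra_simps)
  consider "a = 0" | "a > 0" | "a < 0" by linarith
  then show ?thesis
  proof cases
    case 1
    then show ?thesis using assms by (simp add: field_simps)
  next
    case 2
    then have "(a * t - g)\<^sup>2 \<le> g\<^sup>2 - a * c"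
      using sq mult_nonneg_nonpos[of a, OF _ le] by linarith
    then have "\<bar>a * t - g\<bar> \<le> sqrt (g\<^sup>2 - a * c)"
      using real_sqrt_le_mono by fastforce
    then have "g - sqrt (g\<^sup>2 - a * c) \<le> a * t" by linarith
    with 2 show ?thesis by (simp add: divide_le_eq mult.commute)
  next
    case 3
    then have "g\<^sup>2 - a * c \<le> (a * t - g)\<^sup>2"
      using sq mult_nonpos_nonpos[of a, OF _ le] by linarith
    then have "sqrt (g\<^sup>2 - a * c) \<le> \<bar>a * t - g\<bar>"
      using real_sqrt_le_mono by fastforce
    \<comment> \<open>Here \<open>a * t \<le> 0 < g\<close>, which fixes the sign inside the
      absolute value and so selects the root.\<close>
    also have "\<dots> = g - a * t"
      using 3 assms mult_nonpos_nonneg[of a t] by simp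
    finally have "a * t \<le> g - sqrt (g\<^sup>2 - a * c)" by linarith
    with 3 show ?thesis by (simp add: divide_le_eq mult.commute)
  qed
qed

section \<open>The lower bound for the norm of an optimal solution\<close>

theorem theorem6:
  fixes A :: "real^'n^'m" and b :: "real^'m" and \<rho> :: real
    and L :: "real^'n^'k" and F :: "real^'p^'n"
    and x_opt :: "real^'n" and l2 \<kappa>1 \<kappa>2 :: real
  assumes "1 \<le> CARD('k)" and "CARD('k) \<le> CARD('n)"
    and "\<rho> > 0"
    and "rank L = CARD('k)"
    and "CARD('k) < CARD('n) \<Longrightarrow> CARD('p) = CARD('n) - CARD('k)"
    and "CARD('k) < CARD('n) \<Longrightarrow> columns_orthonormal_basis F (null_space L)"
    and "CARD('k) < CARD('n) \<Longrightarrow>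
      l2 = lambda_min (bordered_matrix
             (transpose F ** transpose A ** A ** F) (transpose F *v (transpose A *v b))
             (b v* A v* F)                          ((norm b)\<^sup>2))"
    and "CARD('k) < CARD('n) \<Longrightarrow> l2 < lambda_min (transpose F ** transpose A ** A ** F)"
    and "transpose A *v b \<noteq> 0"
    and "is_arg_min (rtls_objective A b \<rho> L) (\<lambda>x. x \<in> UNIV) x_opt"
    and "\<kappa>1 =
      (let q = (norm b)\<^sup>2 - (b v* A) \<bullet>
             (matrix_inv (transpose A ** A + \<rho> *\<^sub>R (transpose L ** L)) *v (transpose A *v b))
       in if CARD('k) = CARD('n) then q else min l2 q)"
    and "\<kappa>2 = lambda_min (transpose A ** A + \<rho> *\<^sub>R (transpose L ** L)) - \<kappa>1"
  shows "\<kappa>1 < (norm b)\<^sup>2 \<and>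
    norm x_opt \<ge>
      (if \<kappa>2 = 0 then ((norm b)\<^sup>2 - \<kappa>1) / (2 * norm (transpose A *v b))
       else (norm (transpose A *v b)
              - sqrt ((norm (transpose A *v b))\<^sup>2 - \<kappa>2 * ((norm b)\<^sup>2 - \<kappa>1))) / \<kappa>2)"
proof -
  define B where "B = transpose A ** A + \<rho> *\<^sub>R (transpose L ** L)"
  define w where "w = transpose A *v b"
  define q where "q = (norm b)\<^sup>2 - w \<bullet> (matrix_inv B *v w)"
  define G where "G = A ** F"
  have vA: "b v* A = w"
    by (simp add: w_def transpose_matrix_vector)
  have \<rho>: "\<rho> > 0" by fact
  have \<kappa>1: "\<kappa>1 = (if CARD('k) = CARD('n) then q else min l2 q)"
    using assms(11) by (simp add: Let_def vA q_def flip: B_def w_def)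
  have \<kappa>2: "\<kappa>2 = lambda_min B - \<kappa>1"
    using assms(12) by (simp add: B_def)
  have Bx: "x \<bullet> (B *v x) = (norm (A *v x))\<^sup>2 + \<rho> * (norm (L *v x))\<^sup>2" for x
    by (simp add: B_def matrix_vector_mult_add_rdistrib scaleR_matrix_vector_assoc[symmetric]
        inner_add_right inner_gram)
  have symB: "transpose B = B"
    using transpose_gram[of A] transpose_gram[of L]
    by (simp add: B_def transpose_def vec_eq_iff)
  have opt: "rtls_objective A b \<rho> L x_opt \<le> rtls_objective A b \<rho> L x" for x
    using assms(10) by (auto simp: is_arg_min_def not_less)
  have expand: "(norm (A *v x - b))\<^sup>2 + \<rho> * (norm (L *v x))\<^sup>2 = x \<bullet> (B *v x) - 2 * (w \<bullet> x) + (norm b)\<^sup>2" for x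
  proof -
    have "(norm (A *v x - b))\<^sup>2 = (norm (A *v x))\<^sup>2 - 2 * (b \<bullet> (A *v x)) + (norm b)\<^sup>2"
      unfolding power2_norm_eq_inner
      by (simp add: inner_diff_left inner_diff_right inner_commute[of "A *v x" b])
    then show ?thesis
      by (simp add: Bx w_def dot_lmul_matrix)
  qed
  have gram: "transpose F ** transpose A ** A ** F = transpose G ** G"
    by (simp add: G_def matrix_transpose_mul matrix_mul_assoc)
  have GTb: "transpose F *v (transpose A *v b) = transpose G *v b" "b v* A v* F = transpose G *v b"
    by (simp_all add: G_def matrix_transpose_mul matrix_vector_mul_assoc flip: transpose_matrix_vector)

  \<comment> \<open>The first conjunct comes from \<open>0 \<le> l2\<close> and the strict
    inequality assumed for \<open>l2\<close>; it later yields that \<open>A\<close> is injective on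
    the null space of \<open>L\<close>.\<close>
  have l2: "0 < lambda_min (transpose G ** G) \<and> rtls_objective A b \<rho> L x_opt \<le> l2"
    if lt: "CARD('k) < CARD('n)"
  proof -
    have F: "columns_orthonormal_basis F (null_space L)" using lt by fact
    let ?M = "bordered_matrix (transpose G ** G) (transpose G *v b) (transpose G *v b) ((norm b)\<^sup>2)"
    have l2_eq: "l2 = lambda_min ?M"
      using assms(7)[OF lt] by (simp only: gram GTb)
    have l2_lt: "l2 < lambda_min (transpose G ** G)"
      using assms(8)[OF lt] by (simp only: gram)
    have "l2 \<in> eigenvalues ?M"
      unfolding l2_eq by (intro lambda_min_eigenvalue transpose_bordered_matrix transpose_gram)
    then obtain y s where ys: "y \<noteq> 0 \<or> s \<noteq> 0"
      and ev: "(transpose G ** G) *v y + s *\<^sub>R (transpose G *v b) = l2 *\<^sub>R y"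
      and val: "(norm (G *v y + s *\<^sub>R b))\<^sup>2 = l2 * ((norm y)\<^sup>2 + s\<^sup>2)"
      by (rule bordered_gram_eigenvalueE)
    have pos: "(norm y)\<^sup>2 + s\<^sup>2 > 0"
      using ys by (auto simp: add_pos_nonneg add_nonneg_pos)
    have "0 \<le> l2 * ((norm y)\<^sup>2 + s\<^sup>2)"
      using val by (metis zero_le_power2)
    with pos have "l2 \<ge> 0" by (simp add: zero_le_mult_iff)
    \<comment> \<open>Otherwise \<open>y\<close> would be an eigenvector of the Gram matrix of
      \<open>G\<close> for \<open>l2\<close>, which lies below its least eigenvalue.\<close>
    have s: "s \<noteq> 0"
    proof
      assume "s = 0"
      then have "l2 \<in> eigenvalues (transpose G ** G)"
        using ys ev by (auto simp: eigenvalues_def)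
      with lambda_min_le_eigenvalue[OF transpose_gram] l2_lt show False
        by (metis not_less)
    qed
    \<comment> \<open>Scaling by \<open>r\<close> turns the last coordinate of \<open>(y, s)\<close>
      into -1, so that \<open>r *\<^sub>R (G *v y + s *\<^sub>R b)\<close> becomes a residual
      \<open>A *v x - b\<close>.\<close>
    define r where "r = - 1 / s"
    have r: "r * s = - 1" "r\<^sup>2 = 1 / s\<^sup>2"
      using s by (simp_all add: r_def power_divide)
    define x where "x = F *v (r *\<^sub>R y)"
    have "x \<in> null_space L"
      using columns_orthonormal_basis_range[OF F] unfolding x_def by blast
    then have Lx: "L *v x = 0" by (simp add: null_space_def)
    have nx: "(norm x)\<^sup>2 = (norm y)\<^sup>2 / s\<^sup>2"
      by (simp add: x_def columns_orthonormal_basis_norm[OF F] power_mult_distrib r)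
    have "A *v x - b = r *\<^sub>R (G *v y + s *\<^sub>R b)"
      by (simp add: x_def G_def matrix_vector_mul_assoc[symmetric]
          matrix_vector_mult_scaleR scaleR_add_right r)
    then have nr: "(norm (A *v x - b))\<^sup>2 = l2 * ((norm y)\<^sup>2 + s\<^sup>2) / s\<^sup>2"
      by (simp add: power_mult_distrib r val del: scaleR_add_right)
    have "rtls_objective A b \<rho> L x = l2"
    proof -
      have "(norm x)\<^sup>2 + 1 = ((norm y)\<^sup>2 + s\<^sup>2) / s\<^sup>2"
        using s by (simp add: nx add_divide_distrib)
      then show ?thesis
        using s pos by (simp add: rtls_objective_def Lx nr)
    qed
    with opt[of x] \<open>l2 \<ge> 0\<close> l2_lt show ?thesis by simp
  qed

  \<comment> \<open>Trivial intersection of the two kernels is what makes \<open>B\<close> positive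
    definite. For \<open>k = n\<close> the kernel of \<open>L\<close> is already trivial; for
    \<open>k < n\<close> the positivity in \<open>l2\<close> is used.\<close>
  have null: "x = 0" if Ax: "A *v x = 0" and Lx: "L *v x = 0" for x
  proof (cases "CARD('k) = CARD('n)")
    case True
    then have "inj ((*v) L)"
      using assms(4) full_rank_injective[of L] by simp
    then show ?thesis
      using Lx by (metis injD matrix_vector_mult_0_right)
  next
    case False
    then have lt: "CARD('k) < CARD('n)" using assms(2) by simp
    have F: "columns_orthonormal_basis F (null_space L)" using lt by fact
    obtain y where y: "x = F *v y"
      using columns_orthonormal_basis_range[OF F] Lx by (auto simp: null_space_def)
    have "G *v y = 0"
      using Ax by (simp add: y G_def matrix_vector_mul_assoc)
    then have "lambda_min (transpose G ** G) * (y \<bullet> y) \<le> 0"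
      using lambda_min_le_quadratic_form[OF transpose_gram, of G y] by (simp add: inner_gram)
    then have "y \<bullet> y \<le> 0"
      using l2[OF lt] by (simp add: mult_le_0_iff)
    then have "y = 0"
      by (metis inner_ge_zero inner_eq_zero_iff order_antisym)
    then show ?thesis by (simp add: y)
  qed
  have pd: "x \<bullet> (B *v x) > 0" if "x \<noteq> 0" for x
  proof (rule ccontr)
    assume "\<not> x \<bullet> (B *v x) > 0"
    moreover have "0 \<le> \<rho> * (norm (L *v x))\<^sup>2" using \<rho> by simp
    moreover have "0 \<le> (norm (A *v x))\<^sup>2" by simp
    ultimately have "(norm (A *v x))\<^sup>2 = 0" "\<rho> * (norm (L *v x))\<^sup>2 = 0"
      unfolding Bx by linarith+
    then show False using null[of x] that \<rho> by simp
  qed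
  have "B *v x = 0 \<Longrightarrow> x = 0" for x
    using pd[of x] by fastforce
  then have "invertible B"
    by (simp add: invertible_left_inverse matrix_left_invertible_ker)
  then have Binv: "B ** matrix_inv B = mat 1"
    unfolding invertible_def matrix_inv_def by (metis (mono_tags, lifting) someI_ex)
  define x0 where "x0 = matrix_inv B *v w"
  have Bx0: "B *v x0 = w"
    by (simp add: x0_def matrix_vector_mul_assoc Binv)
  have q_eq: "q = (norm b)\<^sup>2 - w \<bullet> x0" by (simp add: q_def x0_def)
  have "w \<noteq> 0" using assms(9) by (simp add: w_def)
  then have "x0 \<noteq> 0" using Bx0 by auto
  \<comment> \<open>As \<open>w = B *v x0\<close>, the subtracted term \<open>w \<bullet> x0\<close>
    is the form of \<open>B\<close> at \<open>x0\<close>. Taking the minimum with \<open>l2\<close>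
    can only lower the value further.\<close>
  from pd[OF this] have "q < (norm b)\<^sup>2"
    by (simp add: q_eq Bx0 inner_commute)
  then have lt: "\<kappa>1 < (norm b)\<^sup>2" by (auto simp: \<kappa>1)

  \<comment> \<open>The denominator is at least 1, so dropping it only increases the value.\<close>
  have "rtls_objective A b \<rho> L x0 \<le> (norm (A *v x0 - b))\<^sup>2 + \<rho> * (norm (L *v x0))\<^sup>2"
    by (simp add: rtls_objective_def divide_le_eq add_pos_nonneg algebra_simps)
  also have "\<dots> = q"
    by (simp add: expand q_eq Bx0 inner_commute)
  finally have "rtls_objective A b \<rho> L x_opt \<le> q"
    using opt[of x0] by linarith
  then have f_le: "rtls_objective A b \<rho> L x_opt \<le> \<kappa>1"
    using l2 assms(2) by (auto simp: \<kappa>1)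

  define t where "t = norm x_opt"
  have t: "t\<^sup>2 + 1 > 0" by (simp add: add_nonneg_pos)
  \<comment> \<open>The Rayleigh bound for \<open>B\<close> and Cauchy-Schwarz for
    \<open>w \<bullet> x_opt\<close> leave an expression in \<open>t\<close> alone.\<close>
  have "lambda_min B * t\<^sup>2 - 2 * norm w * t + (norm b)\<^sup>2
      \<le> x_opt \<bullet> (B *v x_opt) - 2 * (w \<bullet> x_opt) + (norm b)\<^sup>2"
    using lambda_min_le_quadratic_form[OF symB, of x_opt] norm_cauchy_schwarz[of w x_opt]
    by (simp add: t_def power2_norm_eq_inner)
  also have "\<dots> = (norm (A *v x_opt - b))\<^sup>2 + \<rho> * (norm (L *v x_opt))\<^sup>2"
    by (simp add: expand)
  also have "\<dots> \<le> (norm (A *v x_opt - b))\<^sup>2 + \<rho> * (norm (L *v x_opt))\<^sup>2 * (t\<^sup>2 + 1)"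
    using \<rho> by (simp add: algebra_simps)
  also have "\<dots> = rtls_objective A b \<rho> L x_opt * (t\<^sup>2 + 1)"
    using t by (simp add: rtls_objective_def distrib_right flip: t_def)
  also have "\<dots> \<le> \<kappa>1 * (t\<^sup>2 + 1)"
    using f_le t by (intro mult_right_mono) auto
  finally have "\<kappa>2 * t\<^sup>2 - 2 * norm w * t + ((norm b)\<^sup>2 - \<kappa>1) \<le> 0"
    by (simp add: \<kappa>2 algebra_simps)
  then have "(if \<kappa>2 = 0 then ((norm b)\<^sup>2 - \<kappa>1) / (2 * norm w)
      else (norm w - sqrt ((norm w)\<^sup>2 - \<kappa>2 * ((norm b)\<^sup>2 - \<kappa>1))) / \<kappa>2) \<le> t"
    using \<open>w \<noteq> 0\<close> lt by (intro quadratic_nonpos_lower_bound) (auto simp: t_def)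
  with lt show ?thesis unfolding w_def t_def by blast
qed

end
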